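(* Let $\mathcal{C}$ be a unimodular multitensor category. The canonical Frobenius algebra $\underline{\mathrm{Hom}}(\mathbf{1},\mathbf{1})$ in $\mathcal{C}\boxtimes\mathcal{C}^{\mathrm{op}}$ is connected if and only if $\mathcal{C}$ is a tensor category.
   Context: Terminology follows Etingof–Gelaki–Nikshych–Ostrik, "Tensor Categories": multitensor categories (here finite, so that the internal Homs used below to define the canonical Frobenius algebra exist), and a multitensor category is a tensor category when $\mathrm{End}(\mathbf 1)$ is one-dimensional over the (algebraically closed) base field. $\boxtimes$ is the Deligne tensor product. For a $\mathcal{D}$-module category $\mathcal{M}$ and $M_1,M_2\in\mathcal{M}$, the internal Hom $\underline{\mathrm{Hom}}(M_1,M_2)\in\mathcal{D}$ is defined by the natural isomorphism $\mathrm{Hom}_{\mathcal M}(Y\otimes M_1,M_2)\simeq\mathrm{Hom}_{\mathcal D}(Y,\underline{\mathrm{Hom}}(M_1,M_2))$. Here $\mathcal{D}=\mathcal{C}\boxtimes\mathcal{C}^{\mathrm{op}}$ acts on $\mathcal{M}=\mathcal{C}$ by left and right tensor multiplication, and $\mathbf 1$ is the unit object of $\mathcal{C}$; for $\mathcal{C}$ unimodular, $\underline{\mathrm{Hom}}(\mathbf 1,\mathbf 1)$ is a Frobenius algebra in $\mathcal{D}$, called the canonical Frobenius algebra. An object $A$ of $\mathcal{D}$ is connected if $\mathrm{Hom}_{\mathcal D}(\mathbf 1_{\mathcal D},A)$ is one-dimensional. *)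

theory Defs
  imports "HOL-Computational_Algebra.Polynomial"
begin

section \<open>Linear and abelian categories\<close>

text \<open>
  A \<open>k\<close>-linear category is encoded by placing all of its morphism spaces as subspaces inside one
  ambient \<open>k\<close>-vector space, the type \<^typ>\<open>'m\<close> with scalar multiplication \<open>Scl\<close>.  Distinct morphism
  spaces meet only in \<open>0\<close>: a nonzero arrow knows its source and target, and \<open>0\<close> is the zero arrow of
  every morphism space.  Every (locally small) linear category is of this form, the ambient space
  being the direct sum of its morphism spaces.  The encoding makes \<^const>\<open>vector_space.dim\<close>
  applicable to morphism spaces.  Composition is written in the usual order: \<open>g \<bullet> f\<close> is \<open>g\<close> after
  \<open>f\<close>.
\<close>

record ('o, 'm, 'k) lin_cat =
  Obj :: "'o set"
  Hom :: "'o \<Rightarrow> 'o \<Rightarrow> 'm set"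
  Idt :: "'o \<Rightarrow> 'm"
  Cmp :: "'m \<Rightarrow> 'm \<Rightarrow> 'm"  (infixl "\<bullet>\<index>" 70)
  Scl :: "'k \<Rightarrow> 'm \<Rightarrow> 'm"

locale linear_category =
  fixes C :: "('o, 'm::ab_group_add, 'k::field, 'x) lin_cat_scheme" (structure)
  assumes scl: "vector_space (Scl C)"
    and hom_obj: "f \<in> Hom C X Y \<Longrightarrow> X \<in> Obj C \<and> Y \<in> Obj C"
    and hom_subspace: "\<lbrakk>X \<in> Obj C; Y \<in> Obj C\<rbrakk> \<Longrightarrow> module.subspace (Scl C) (Hom C X Y)"
    and hom_disjoint:
      "\<lbrakk>f \<in> Hom C X Y; f \<in> Hom C X' Y'; f \<noteq> 0\<rbrakk> \<Longrightarrow> X = X' \<and> Y = Y'"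
    and idt_hom: "X \<in> Obj C \<Longrightarrow> Idt C X \<in> Hom C X X"
    and cmp_hom: "\<lbrakk>f \<in> Hom C X Y; g \<in> Hom C Y Z\<rbrakk> \<Longrightarrow> g \<bullet> f \<in> Hom C X Z"
    and idt_left: "f \<in> Hom C X Y \<Longrightarrow> Idt C Y \<bullet> f = f"
    and idt_right: "f \<in> Hom C X Y \<Longrightarrow> f \<bullet> Idt C X = f"
    and cmp_assoc:
      "\<lbrakk>f \<in> Hom C W X; g \<in> Hom C X Y; h \<in> Hom C Y Z\<rbrakk> \<Longrightarrow> (h \<bullet> g) \<bullet> f = h \<bullet> (g \<bullet> f)"
    and cmp_add_left:
      "\<lbrakk>f \<in> Hom C X Y; g \<in> Hom C Y Z; g' \<in> Hom C Y Z\<rbrakk> \<Longrightarrow> (g + g') \<bullet> f = g \<bullet> f + g' \<bullet> f"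
    and cmp_add_right:
      "\<lbrakk>f \<in> Hom C X Y; f' \<in> Hom C X Y; g \<in> Hom C Y Z\<rbrakk> \<Longrightarrow> g \<bullet> (f + f') = g \<bullet> f + g \<bullet> f'"
    and cmp_scl_left:
      "\<lbrakk>f \<in> Hom C X Y; g \<in> Hom C Y Z\<rbrakk> \<Longrightarrow> Scl C c g \<bullet> f = Scl C c (g \<bullet> f)"
    and cmp_scl_right:
      "\<lbrakk>f \<in> Hom C X Y; g \<in> Hom C Y Z\<rbrakk> \<Longrightarrow> g \<bullet> Scl C c f = Scl C c (g \<bullet> f)"

definition is_inverse ::
  "('o, 'm, 'k, 'x) lin_cat_scheme \<Rightarrow> 'o \<Rightarrow> 'o \<Rightarrow> 'm \<Rightarrow> 'm \<Rightarrow> bool" where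
  "is_inverse C X Y f g \<longleftrightarrow>
     g \<in> Hom C Y X \<and> g \<bullet>\<^bsub>C\<^esub> f = Idt C X \<and> f \<bullet>\<^bsub>C\<^esub> g = Idt C Y"

definition iso_arr :: "('o, 'm, 'k, 'x) lin_cat_scheme \<Rightarrow> 'o \<Rightarrow> 'o \<Rightarrow> 'm \<Rightarrow> bool" where
  "iso_arr C X Y f \<longleftrightarrow> f \<in> Hom C X Y \<and> (\<exists>g. is_inverse C X Y f g)"

definition inv_arr :: "('o, 'm, 'k, 'x) lin_cat_scheme \<Rightarrow> 'o \<Rightarrow> 'o \<Rightarrow> 'm \<Rightarrow> 'm" where
  "inv_arr C X Y f = (THE g. is_inverse C X Y f g)"

definition isomorphic :: "('o, 'm, 'k, 'x) lin_cat_scheme \<Rightarrow> 'o \<Rightarrow> 'o \<Rightarrow> bool" where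
  "isomorphic C X Y \<longleftrightarrow> (\<exists>f. iso_arr C X Y f)"

definition mono_arr :: "('o, 'm, 'k, 'x) lin_cat_scheme \<Rightarrow> 'o \<Rightarrow> 'o \<Rightarrow> 'm \<Rightarrow> bool" where
  "mono_arr C X Y f \<longleftrightarrow> f \<in> Hom C X Y \<and>
     (\<forall>W. \<forall>g\<in>Hom C W X. \<forall>h\<in>Hom C W X. f \<bullet>\<^bsub>C\<^esub> g = f \<bullet>\<^bsub>C\<^esub> h \<longrightarrow> g = h)"

definition epi_arr :: "('o, 'm, 'k, 'x) lin_cat_scheme \<Rightarrow> 'o \<Rightarrow> 'o \<Rightarrow> 'm \<Rightarrow> bool" where
  "epi_arr C X Y f \<longleftrightarrow> f \<in> Hom C X Y \<and>
     (\<forall>W. \<forall>g\<in>Hom C Y W. \<forall>h\<in>Hom C Y W. g \<bullet>\<^bsub>C\<^esub> f = h \<bullet>\<^bsub>C\<^esub> f \<longrightarrow> g = h)"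

definition zero_obj :: "('o, 'm::zero, 'k, 'x) lin_cat_scheme \<Rightarrow> 'o \<Rightarrow> bool" where
  "zero_obj C Z \<longleftrightarrow> Z \<in> Obj C \<and> Hom C Z Z = {0}"

text \<open>\<open>is_kernel C X Y f K i\<close>: the arrow \<open>i : K \<rightarrow> X\<close> is a kernel of \<open>f : X \<rightarrow> Y\<close>; dually for cokernels.\<close>

definition is_kernel ::
  "('o, 'm::zero, 'k, 'x) lin_cat_scheme \<Rightarrow> 'o \<Rightarrow> 'o \<Rightarrow> 'm \<Rightarrow> 'o \<Rightarrow> 'm \<Rightarrow> bool" where
  "is_kernel C X Y f K i \<longleftrightarrow>
     f \<in> Hom C X Y \<and> i \<in> Hom C K X \<and> f \<bullet>\<^bsub>C\<^esub> i = 0 \<and>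
     (\<forall>W. \<forall>g\<in>Hom C W X. f \<bullet>\<^bsub>C\<^esub> g = 0 \<longrightarrow> (\<exists>!h. h \<in> Hom C W K \<and> i \<bullet>\<^bsub>C\<^esub> h = g))"

definition is_cokernel ::
  "('o, 'm::zero, 'k, 'x) lin_cat_scheme \<Rightarrow> 'o \<Rightarrow> 'o \<Rightarrow> 'm \<Rightarrow> 'o \<Rightarrow> 'm \<Rightarrow> bool" where
  "is_cokernel C X Y f Q q \<longleftrightarrow>
     f \<in> Hom C X Y \<and> q \<in> Hom C Y Q \<and> q \<bullet>\<^bsub>C\<^esub> f = 0 \<and>
     (\<forall>W. \<forall>g\<in>Hom C Y W. g \<bullet>\<^bsub>C\<^esub> f = 0 \<longrightarrow> (\<exists>!h. h \<in> Hom C Q W \<and> h \<bullet>\<^bsub>C\<^esub> q = g))"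

definition short_exact ::
  "('o, 'm::zero, 'k, 'x) lin_cat_scheme \<Rightarrow> 'o \<Rightarrow> 'o \<Rightarrow> 'o \<Rightarrow> 'm \<Rightarrow> 'm \<Rightarrow> bool" where
  "short_exact C X Y Z f g \<longleftrightarrow> is_kernel C Y Z g X f \<and> is_cokernel C X Y f Z g"

locale abelian_category = linear_category C
  for C :: "('o, 'm::ab_group_add, 'k::field, 'x) lin_cat_scheme" (structure) +
  assumes ex_zero: "\<exists>Z. zero_obj C Z"
    and ex_biproduct:
      "\<lbrakk>X \<in> Obj C; Y \<in> Obj C\<rbrakk> \<Longrightarrow>
         \<exists>S. \<exists>i\<in>Hom C X S. \<exists>j\<in>Hom C Y S. \<exists>p\<in>Hom C S X. \<exists>q\<in>Hom C S Y.
           p \<bullet> i = Idt C X \<and> q \<bullet> j = Idt C Y \<and> i \<bullet> p + j \<bullet> q = Idt C S"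
    and canonical_decomposition:
      "f \<in> Hom C X Y \<Longrightarrow>
         \<exists>K k I e m Q c. e \<in> Hom C X I \<and> m \<in> Hom C I Y \<and> m \<bullet> e = f \<and>
           is_kernel C X Y f K k \<and> is_cokernel C X Y f Q c \<and>
           is_cokernel C K X k I e \<and> is_kernel C Y Q c I m"

section \<open>Finiteness conditions\<close>

definition simple_obj :: "('o, 'm::zero, 'k, 'x) lin_cat_scheme \<Rightarrow> 'o \<Rightarrow> bool" where
  "simple_obj C X \<longleftrightarrow> X \<in> Obj C \<and> \<not> zero_obj C X \<and>
     (\<forall>Y f. mono_arr C Y X f \<longrightarrow> zero_obj C Y \<or> iso_arr C Y X f)"

text \<open>A finite filtration from a zero object up to \<open>X\<close> with simple successive quotients.\<close>

definition finite_length :: "('o, 'm::zero, 'k, 'x) lin_cat_scheme \<Rightarrow> 'o \<Rightarrow> bool" where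
  "finite_length C X \<longleftrightarrow>
     (\<exists>(n::nat) F j. zero_obj C (F 0) \<and> F n = X \<and>
        (\<forall>i<n. \<exists>S q. simple_obj C S \<and> short_exact C (F i) (F (Suc i)) S (j i) q))"

definition semisimple_obj :: "('o, 'm::ab_group_add, 'k, 'x) lin_cat_scheme \<Rightarrow> 'o \<Rightarrow> bool" where
  "semisimple_obj C X \<longleftrightarrow> X \<in> Obj C \<and>
     (\<exists>(n::nat) S i p.
        (\<forall>a<n. simple_obj C (S a) \<and> i a \<in> Hom C (S a) X \<and> p a \<in> Hom C X (S a)) \<and>
        (\<forall>a<n. \<forall>b<n. p a \<bullet>\<^bsub>C\<^esub> i b = (if a = b then Idt C (S a) else 0)) \<and>
        (\<Sum>a<n. i a \<bullet>\<^bsub>C\<^esub> p a) = Idt C X)"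

definition projective_obj :: "('o, 'm, 'k, 'x) lin_cat_scheme \<Rightarrow> 'o \<Rightarrow> bool" where
  "projective_obj C P \<longleftrightarrow> P \<in> Obj C \<and>
     (\<forall>Y Z f. \<forall>g\<in>Hom C P Z. epi_arr C Y Z f \<longrightarrow> (\<exists>h\<in>Hom C P Y. f \<bullet>\<^bsub>C\<^esub> h = g))"

definition projective_cover :: "('o, 'm, 'k, 'x) lin_cat_scheme \<Rightarrow> 'o \<Rightarrow> 'o \<Rightarrow> 'm \<Rightarrow> bool" where
  "projective_cover C X P p \<longleftrightarrow> projective_obj C P \<and> epi_arr C P X p \<and>
     (\<forall>P' g. projective_obj C P' \<and> epi_arr C P' X g \<longrightarrow>
        (\<exists>h. epi_arr C P' P h \<and> p \<bullet>\<^bsub>C\<^esub> h = g))"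

locale locally_finite_category = abelian_category C
  for C :: "('o, 'm::ab_group_add, 'k::field, 'x) lin_cat_scheme" (structure) +
  assumes hom_finite_dim:
      "\<lbrakk>X \<in> Obj C; Y \<in> Obj C\<rbrakk> \<Longrightarrow> \<exists>B. finite B \<and> Hom C X Y = module.span (Scl C) B"
    and obj_finite_length: "X \<in> Obj C \<Longrightarrow> finite_length C X"

locale finite_category = locally_finite_category C
  for C :: "('o, 'm::ab_group_add, 'k::field, 'x) lin_cat_scheme" (structure) +
  assumes enough_projectives: "simple_obj C S \<Longrightarrow> \<exists>P p. projective_cover C S P p"
    and finitely_many_simples:
      "\<exists>R. finite R \<and> (\<forall>S. simple_obj C S \<longrightarrow> (\<exists>T\<in>R. isomorphic C S T))"

section \<open>Functors and bifunctors\<close>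

text \<open>A functor is a pair of maps, on objects and on arrows; likewise a bifunctor.\<close>

locale linear_functor =
  fixes A :: "('a, 'm::ab_group_add, 'k::field, 'x) lin_cat_scheme"
    and B :: "('b, 'n::ab_group_add, 'k, 'y) lin_cat_scheme"
    and FO :: "'a \<Rightarrow> 'b" and FM :: "'m \<Rightarrow> 'n"
  assumes obj: "X \<in> Obj A \<Longrightarrow> FO X \<in> Obj B"
    and arr: "f \<in> Hom A X Y \<Longrightarrow> FM f \<in> Hom B (FO X) (FO Y)"
    and idt: "X \<in> Obj A \<Longrightarrow> FM (Idt A X) = Idt B (FO X)"
    and cmp: "\<lbrakk>f \<in> Hom A X Y; g \<in> Hom A Y Z\<rbrakk> \<Longrightarrow> FM (g \<bullet>\<^bsub>A\<^esub> f) = FM g \<bullet>\<^bsub>B\<^esub> FM f"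
    and add: "\<lbrakk>f \<in> Hom A X Y; g \<in> Hom A X Y\<rbrakk> \<Longrightarrow> FM (f + g) = FM f + FM g"
    and scl: "f \<in> Hom A X Y \<Longrightarrow> FM (Scl A c f) = Scl B c (FM f)"

definition exact ::
  "('a, 'm::zero, 'k, 'x) lin_cat_scheme \<Rightarrow> ('b, 'n::zero, 'k, 'y) lin_cat_scheme
     \<Rightarrow> ('a \<Rightarrow> 'b) \<Rightarrow> ('m \<Rightarrow> 'n) \<Rightarrow> bool" where
  "exact A B FO FM \<longleftrightarrow>
     (\<forall>X Y Z f g. short_exact A X Y Z f g \<longrightarrow>
        short_exact B (FO X) (FO Y) (FO Z) (FM f) (FM g))"

text \<open>Exactness of \<open>F X \<rightarrow> F Y \<rightarrow> F Z \<rightarrow> 0\<close> says that \<open>F Y \<rightarrow> F Z\<close> is a cokernel of \<open>F X \<rightarrow> F Y\<close>.\<close>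

definition right_exact ::
  "('a, 'm::zero, 'k, 'x) lin_cat_scheme \<Rightarrow> ('b, 'n::zero, 'k, 'y) lin_cat_scheme
     \<Rightarrow> ('a \<Rightarrow> 'b) \<Rightarrow> ('m \<Rightarrow> 'n) \<Rightarrow> bool" where
  "right_exact A B FO FM \<longleftrightarrow>
     (\<forall>X Y Z f g. short_exact A X Y Z f g \<longrightarrow>
        is_cokernel B (FO X) (FO Y) (FM f) (FO Z) (FM g))"

definition nat_trans ::
  "('a, 'm, 'k, 'x) lin_cat_scheme \<Rightarrow> ('b, 'n, 'k, 'y) lin_cat_scheme
     \<Rightarrow> ('a \<Rightarrow> 'b) \<Rightarrow> ('m \<Rightarrow> 'n) \<Rightarrow> ('a \<Rightarrow> 'b) \<Rightarrow> ('m \<Rightarrow> 'n) \<Rightarrow> ('a \<Rightarrow> 'n) \<Rightarrow> bool" where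
  "nat_trans A B FO FM GO GM \<alpha> \<longleftrightarrow>
     (\<forall>X\<in>Obj A. \<alpha> X \<in> Hom B (FO X) (GO X)) \<and>
     (\<forall>X Y. \<forall>f\<in>Hom A X Y. \<alpha> Y \<bullet>\<^bsub>B\<^esub> FM f = GM f \<bullet>\<^bsub>B\<^esub> \<alpha> X)"

locale bilinear_bifunctor =
  fixes A :: "('a, 'm::ab_group_add, 'k::field, 'x) lin_cat_scheme"
    and B :: "('b, 'n::ab_group_add, 'k, 'y) lin_cat_scheme"
    and E :: "('e, 'p::ab_group_add, 'k, 'z) lin_cat_scheme"
    and FO :: "'a \<Rightarrow> 'b \<Rightarrow> 'e" and FM :: "'m \<Rightarrow> 'n \<Rightarrow> 'p"
  assumes obj: "\<lbrakk>X \<in> Obj A; Y \<in> Obj B\<rbrakk> \<Longrightarrow> FO X Y \<in> Obj E"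
    and arr: "\<lbrakk>f \<in> Hom A X X'; g \<in> Hom B Y Y'\<rbrakk> \<Longrightarrow> FM f g \<in> Hom E (FO X Y) (FO X' Y')"
    and idt: "\<lbrakk>X \<in> Obj A; Y \<in> Obj B\<rbrakk> \<Longrightarrow> FM (Idt A X) (Idt B Y) = Idt E (FO X Y)"
    and cmp:
      "\<lbrakk>f \<in> Hom A X X'; f' \<in> Hom A X' X''; g \<in> Hom B Y Y'; g' \<in> Hom B Y' Y''\<rbrakk> \<Longrightarrow>
         FM (f' \<bullet>\<^bsub>A\<^esub> f) (g' \<bullet>\<^bsub>B\<^esub> g) = FM f' g' \<bullet>\<^bsub>E\<^esub> FM f g"
    and add_left:
      "\<lbrakk>f \<in> Hom A X X'; f' \<in> Hom A X X'; g \<in> Hom B Y Y'\<rbrakk> \<Longrightarrow> FM (f + f') g = FM f g + FM f' g"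
    and add_right:
      "\<lbrakk>f \<in> Hom A X X'; g \<in> Hom B Y Y'; g' \<in> Hom B Y Y'\<rbrakk> \<Longrightarrow> FM f (g + g') = FM f g + FM f g'"
    and scl_left: "\<lbrakk>f \<in> Hom A X X'; g \<in> Hom B Y Y'\<rbrakk> \<Longrightarrow> FM (Scl A c f) g = Scl E c (FM f g)"
    and scl_right: "\<lbrakk>f \<in> Hom A X X'; g \<in> Hom B Y Y'\<rbrakk> \<Longrightarrow> FM f (Scl B c g) = Scl E c (FM f g)"

definition right_exact_bifunctor ::
  "('a, 'm::ab_group_add, 'k::field, 'x) lin_cat_scheme
     \<Rightarrow> ('b, 'n::ab_group_add, 'k, 'y) lin_cat_scheme
     \<Rightarrow> ('e, 'p::ab_group_add, 'k, 'z) lin_cat_scheme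
     \<Rightarrow> ('a \<Rightarrow> 'b \<Rightarrow> 'e) \<Rightarrow> ('m \<Rightarrow> 'n \<Rightarrow> 'p) \<Rightarrow> bool" where
  "right_exact_bifunctor A B E FO FM \<longleftrightarrow> bilinear_bifunctor A B E FO FM \<and>
     (\<forall>Y\<in>Obj B. right_exact A E (\<lambda>X. FO X Y) (\<lambda>f. FM f (Idt B Y))) \<and>
     (\<forall>X\<in>Obj A. right_exact B E (FO X) (FM (Idt A X)))"

definition bifun_nat_trans ::
  "('a, 'm, 'k, 'x) lin_cat_scheme \<Rightarrow> ('b, 'n, 'k, 'y) lin_cat_scheme
     \<Rightarrow> ('e, 'p, 'k, 'z) lin_cat_scheme
     \<Rightarrow> ('a \<Rightarrow> 'b \<Rightarrow> 'e) \<Rightarrow> ('m \<Rightarrow> 'n \<Rightarrow> 'p) \<Rightarrow> ('a \<Rightarrow> 'b \<Rightarrow> 'e) \<Rightarrow> ('m \<Rightarrow> 'n \<Rightarrow> 'p)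
     \<Rightarrow> ('a \<Rightarrow> 'b \<Rightarrow> 'p) \<Rightarrow> bool" where
  "bifun_nat_trans A B E FO FM GO GM \<alpha> \<longleftrightarrow>
     (\<forall>X\<in>Obj A. \<forall>Y\<in>Obj B. \<alpha> X Y \<in> Hom E (FO X Y) (GO X Y)) \<and>
     (\<forall>X X' Y Y'. \<forall>f\<in>Hom A X X'. \<forall>g\<in>Hom B Y Y'.
        \<alpha> X' Y' \<bullet>\<^bsub>E\<^esub> FM f g = GM f g \<bullet>\<^bsub>E\<^esub> \<alpha> X Y)"

section \<open>The Deligne tensor product\<close>

text \<open>
  \<open>(P, \<boxtimes>)\<close> is a Deligne tensor product of \<open>A\<close> and \<open>B\<close>: the bifunctor \<open>\<boxtimes> : A \<times> B \<rightarrow> P\<close> is right exact in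
  both variables, and for every abelian linear category \<open>E\<close>, restriction along \<open>\<boxtimes>\<close> is an equivalence
  from right exact functors \<open>P \<rightarrow> E\<close> to bifunctors \<open>A \<times> B \<rightarrow> E\<close> that are right exact in both
  variables.  The first conjunct under the quantifier over \<open>E\<close> is essential surjectivity, the second
  is full faithfulness.

  A definition in HOL cannot quantify over types, so the types of objects and of arrows of the test
  categories \<open>E\<close> are parameters.  A theorem that assumes \<open>deligne_product\<close> for arbitrary type
  parameters covers all \<open>P\<close> with the universal property in all types.
\<close>

definition deligne_product ::
  "'e itself \<Rightarrow> 'q::ab_group_add itself
     \<Rightarrow> ('a, 'm::ab_group_add, 'k::field, 'x) lin_cat_scheme
     \<Rightarrow> ('b, 'n::ab_group_add, 'k, 'y) lin_cat_scheme
     \<Rightarrow> ('d, 'p::ab_group_add, 'k, 'z) lin_cat_scheme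
     \<Rightarrow> ('a \<Rightarrow> 'b \<Rightarrow> 'd) \<Rightarrow> ('m \<Rightarrow> 'n \<Rightarrow> 'p) \<Rightarrow> bool" where
  "deligne_product _ _ A B P boxO boxM \<longleftrightarrow>
     abelian_category P \<and>
     right_exact_bifunctor A B P boxO boxM \<and>
     (\<forall>E :: ('e, 'q, 'k) lin_cat. abelian_category E \<longrightarrow>
        (\<forall>GO GM. right_exact_bifunctor A B E GO GM \<longrightarrow>
           (\<exists>HO HM \<eta>. linear_functor P E HO HM \<and> right_exact P E HO HM \<and>
              bifun_nat_trans A B E (\<lambda>X Y. HO (boxO X Y)) (\<lambda>f g. HM (boxM f g)) GO GM \<eta> \<and>
              (\<forall>X\<in>Obj A. \<forall>Y\<in>Obj B. iso_arr E (HO (boxO X Y)) (GO X Y) (\<eta> X Y)))) \<and>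
        (\<forall>HO HM KO KM \<alpha>.
           linear_functor P E HO HM \<and> right_exact P E HO HM \<and>
           linear_functor P E KO KM \<and> right_exact P E KO KM \<and>
           bifun_nat_trans A B E (\<lambda>X Y. HO (boxO X Y)) (\<lambda>f g. HM (boxM f g))
             (\<lambda>X Y. KO (boxO X Y)) (\<lambda>f g. KM (boxM f g)) \<alpha> \<longrightarrow>
           (\<exists>\<beta>. nat_trans P E HO HM KO KM \<beta> \<and>
              (\<forall>X\<in>Obj A. \<forall>Y\<in>Obj B. \<beta> (boxO X Y) = \<alpha> X Y) \<and>
              (\<forall>\<beta>'. nat_trans P E HO HM KO KM \<beta>' \<and>
                 (\<forall>X\<in>Obj A. \<forall>Y\<in>Obj B. \<beta>' (boxO X Y) = \<alpha> X Y) \<longrightarrow>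
                 (\<forall>Z\<in>Obj P. \<beta>' Z = \<beta> Z)))))"

section \<open>Monoidal, multitensor and tensor categories\<close>

record ('o, 'm, 'k) mon_cat = "('o, 'm, 'k) lin_cat" +
  Ten :: "'o \<Rightarrow> 'o \<Rightarrow> 'o"  (infixl "\<otimes>\<index>" 75)
  TenM :: "'m \<Rightarrow> 'm \<Rightarrow> 'm"  (infixl "\<odot>\<index>" 75)
  Unit :: "'o"  ("\<one>\<index>")
  Asc :: "'o \<Rightarrow> 'o \<Rightarrow> 'o \<Rightarrow> 'm"
  Lun :: "'o \<Rightarrow> 'm"
  Run :: "'o \<Rightarrow> 'm"

locale linear_monoidal_category = linear_category C + tensor: bilinear_bifunctor C C C "Ten C" "TenM C"
  for C :: "('o, 'm::ab_group_add, 'k::field, 'x) mon_cat_scheme" (structure) +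
  assumes unit_obj: "\<one> \<in> Obj C"
    and asc_iso:
      "\<lbrakk>X \<in> Obj C; Y \<in> Obj C; Z \<in> Obj C\<rbrakk> \<Longrightarrow>
         iso_arr C ((X \<otimes> Y) \<otimes> Z) (X \<otimes> (Y \<otimes> Z)) (Asc C X Y Z)"
    and asc_natural:
      "\<lbrakk>f \<in> Hom C X X'; g \<in> Hom C Y Y'; h \<in> Hom C Z Z'\<rbrakk> \<Longrightarrow>
         Asc C X' Y' Z' \<bullet> ((f \<odot> g) \<odot> h) = (f \<odot> (g \<odot> h)) \<bullet> Asc C X Y Z"
    and lun_iso: "X \<in> Obj C \<Longrightarrow> iso_arr C (\<one> \<otimes> X) X (Lun C X)"
    and lun_natural: "f \<in> Hom C X Y \<Longrightarrow> Lun C Y \<bullet> (Idt C \<one> \<odot> f) = f \<bullet> Lun C X"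
    and run_iso: "X \<in> Obj C \<Longrightarrow> iso_arr C (X \<otimes> \<one>) X (Run C X)"
    and run_natural: "f \<in> Hom C X Y \<Longrightarrow> Run C Y \<bullet> (f \<odot> Idt C \<one>) = f \<bullet> Run C X"
    and pentagon:
      "\<lbrakk>W \<in> Obj C; X \<in> Obj C; Y \<in> Obj C; Z \<in> Obj C\<rbrakk> \<Longrightarrow>
         Asc C W X (Y \<otimes> Z) \<bullet> Asc C (W \<otimes> X) Y Z =
         (Idt C W \<odot> Asc C X Y Z) \<bullet> Asc C W (X \<otimes> Y) Z \<bullet> (Asc C W X Y \<odot> Idt C Z)"
    and triangle:
      "\<lbrakk>X \<in> Obj C; Y \<in> Obj C\<rbrakk> \<Longrightarrow>
         (Idt C X \<odot> Lun C Y) \<bullet> Asc C X \<one> Y = Run C X \<odot> Idt C Y"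

text \<open>
  \<open>is_left_dual C X X' ev coev\<close>: \<open>X'\<close> with \<open>ev : X' \<otimes> X \<rightarrow> \<one>\<close> and \<open>coev : \<one> \<rightarrow> X \<otimes> X'\<close> is a left dual of
  \<open>X\<close>.  Equivalently, \<open>X\<close> with the same arrows is a right dual of \<open>X'\<close>.
\<close>

definition is_left_dual ::
  "('o, 'm, 'k, 'x) mon_cat_scheme \<Rightarrow> 'o \<Rightarrow> 'o \<Rightarrow> 'm \<Rightarrow> 'm \<Rightarrow> bool" where
  "is_left_dual C X X' ev coev \<longleftrightarrow>
     X \<in> Obj C \<and> X' \<in> Obj C \<and>
     ev \<in> Hom C (X' \<otimes>\<^bsub>C\<^esub> X) \<one>\<^bsub>C\<^esub> \<and> coev \<in> Hom C \<one>\<^bsub>C\<^esub> (X \<otimes>\<^bsub>C\<^esub> X') \<and>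
     Run C X \<bullet>\<^bsub>C\<^esub> (Idt C X \<odot>\<^bsub>C\<^esub> ev) \<bullet>\<^bsub>C\<^esub> Asc C X X' X \<bullet>\<^bsub>C\<^esub> (coev \<odot>\<^bsub>C\<^esub> Idt C X) = Lun C X \<and>
     Lun C X' \<bullet>\<^bsub>C\<^esub> (ev \<odot>\<^bsub>C\<^esub> Idt C X')
       \<bullet>\<^bsub>C\<^esub> inv_arr C ((X' \<otimes>\<^bsub>C\<^esub> X) \<otimes>\<^bsub>C\<^esub> X') (X' \<otimes>\<^bsub>C\<^esub> (X \<otimes>\<^bsub>C\<^esub> X')) (Asc C X' X X')
       \<bullet>\<^bsub>C\<^esub> (Idt C X' \<odot>\<^bsub>C\<^esub> coev) = Run C X'"

locale multitensor_category = locally_finite_category C + linear_monoidal_category C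
  for C :: "('o, 'm::ab_group_add, 'k::field, 'x) mon_cat_scheme" (structure) +
  assumes ex_left_dual: "X \<in> Obj C \<Longrightarrow> \<exists>X' ev coev. is_left_dual C X X' ev coev"
    and ex_right_dual: "X \<in> Obj C \<Longrightarrow> \<exists>X' ev coev. is_left_dual C X' X ev coev"

locale finite_multitensor_category = multitensor_category C + finite_category C
  for C :: "('o, 'm::ab_group_add, 'k::field, 'x) mon_cat_scheme" (structure)

definition tensor_category ::
  "('o, 'm::ab_group_add, 'k::field, 'x) mon_cat_scheme \<Rightarrow> bool" where
  "tensor_category C \<longleftrightarrow>
     multitensor_category C \<and> vector_space.dim (Scl C) (Hom C \<one>\<^bsub>C\<^esub> \<one>\<^bsub>C\<^esub>) = 1"

definition connected_obj ::
  "('o, 'm::ab_group_add, 'k::field, 'x) mon_cat_scheme \<Rightarrow> 'o \<Rightarrow> bool" where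
  "connected_obj C X \<longleftrightarrow> vector_space.dim (Scl C) (Hom C \<one>\<^bsub>C\<^esub> X) = 1"

text \<open>
  The distinguished invertible object \<open>D\<close> is determined up to isomorphism by \<open>P(\<one>)\<^sup>* \<cong> P(D)\<close>, where
  \<open>P(_)\<close> denotes projective covers.  In a tensor category \<open>D\<close> is simple; in a multitensor category
  \<open>\<one>\<close> is only semisimple, and \<open>D\<close> is the semisimple object with this property.
\<close>

definition distinguished_obj ::
  "('o, 'm::ab_group_add, 'k, 'x) mon_cat_scheme \<Rightarrow> 'o \<Rightarrow> bool" where
  "distinguished_obj C D \<longleftrightarrow> semisimple_obj C D \<and>
     (\<exists>P p P' ev coev q. projective_cover C \<one>\<^bsub>C\<^esub> P p \<and> is_left_dual C P P' ev coev \<and>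
        projective_cover C D P' q)"

definition unimodular :: "('o, 'm::ab_group_add, 'k, 'x) mon_cat_scheme \<Rightarrow> bool" where
  "unimodular C \<longleftrightarrow> (\<exists>D. distinguished_obj C D \<and> isomorphic C D \<one>\<^bsub>C\<^esub>)"

text \<open>The same category with the opposite tensor product (arrows are not reversed).\<close>

definition rev_mon :: "('o, 'm, 'k) mon_cat \<Rightarrow> ('o, 'm, 'k) mon_cat" where
  "rev_mon C = C\<lparr>
     Ten := \<lambda>X Y. Y \<otimes>\<^bsub>C\<^esub> X,
     TenM := \<lambda>f g. g \<odot>\<^bsub>C\<^esub> f,
     Asc := \<lambda>X Y Z. inv_arr C ((Z \<otimes>\<^bsub>C\<^esub> Y) \<otimes>\<^bsub>C\<^esub> X) (Z \<otimes>\<^bsub>C\<^esub> (Y \<otimes>\<^bsub>C\<^esub> X)) (Asc C Z Y X),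
     Lun := Run C,
     Run := Lun C\<rparr>"

text \<open>
  The tensor product of a Deligne product of monoidal categories is right exact in both variables and
  extends \<open>(X \<boxtimes> Y) \<otimes> (X' \<boxtimes> Y') = (X \<otimes> X') \<boxtimes> (Y \<otimes> Y')\<close>: the bifunctor \<open>\<boxtimes>\<close> is monoidal, with structure
  isomorphisms \<open>J X Y X' Y' : (X \<boxtimes> Y) \<otimes> (X' \<boxtimes> Y') \<rightarrow> (X \<otimes> X') \<boxtimes> (Y \<otimes> Y')\<close> and \<open>J0 : \<one> \<rightarrow> \<one> \<boxtimes> \<one>\<close>.
\<close>

locale monoidal_deligne_product = P: linear_monoidal_category P
  for te :: "'e itself" and tq :: "'q::ab_group_add itself"
    and A :: "('a, 'm::ab_group_add, 'k::field) mon_cat"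
    and B :: "('b, 'n::ab_group_add, 'k) mon_cat"
    and P :: "('d, 'p::ab_group_add, 'k) mon_cat"
    and boxO :: "'a \<Rightarrow> 'b \<Rightarrow> 'd" and boxM :: "'m \<Rightarrow> 'n \<Rightarrow> 'p"
    and J :: "'a \<Rightarrow> 'b \<Rightarrow> 'a \<Rightarrow> 'b \<Rightarrow> 'p" and J0 :: 'p +
  assumes universal: "deligne_product te tq A B P boxO boxM"
    and tensor_right_exact: "right_exact_bifunctor P P P (Ten P) (TenM P)"
    and J_iso:
      "\<lbrakk>X \<in> Obj A; Y \<in> Obj B; X' \<in> Obj A; Y' \<in> Obj B\<rbrakk> \<Longrightarrow>
         iso_arr P (boxO X Y \<otimes>\<^bsub>P\<^esub> boxO X' Y') (boxO (X \<otimes>\<^bsub>A\<^esub> X') (Y \<otimes>\<^bsub>B\<^esub> Y')) (J X Y X' Y')"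
    and J_natural:
      "\<lbrakk>f \<in> Hom A X Z; g \<in> Hom B Y W; f' \<in> Hom A X' Z'; g' \<in> Hom B Y' W'\<rbrakk> \<Longrightarrow>
         J Z W Z' W' \<bullet>\<^bsub>P\<^esub> (boxM f g \<odot>\<^bsub>P\<^esub> boxM f' g') =
         boxM (f \<odot>\<^bsub>A\<^esub> f') (g \<odot>\<^bsub>B\<^esub> g') \<bullet>\<^bsub>P\<^esub> J X Y X' Y'"
    and J_asc:
      "\<lbrakk>X \<in> Obj A; Y \<in> Obj B; X' \<in> Obj A; Y' \<in> Obj B; X'' \<in> Obj A; Y'' \<in> Obj B\<rbrakk> \<Longrightarrow>
         J X Y (X' \<otimes>\<^bsub>A\<^esub> X'') (Y' \<otimes>\<^bsub>B\<^esub> Y'')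
           \<bullet>\<^bsub>P\<^esub> (Idt P (boxO X Y) \<odot>\<^bsub>P\<^esub> J X' Y' X'' Y'')
           \<bullet>\<^bsub>P\<^esub> Asc P (boxO X Y) (boxO X' Y') (boxO X'' Y'') =
         boxM (Asc A X X' X'') (Asc B Y Y' Y'')
           \<bullet>\<^bsub>P\<^esub> J (X \<otimes>\<^bsub>A\<^esub> X') (Y \<otimes>\<^bsub>B\<^esub> Y') X'' Y''
           \<bullet>\<^bsub>P\<^esub> (J X Y X' Y' \<odot>\<^bsub>P\<^esub> Idt P (boxO X'' Y''))"
    and J0_iso: "iso_arr P \<one>\<^bsub>P\<^esub> (boxO \<one>\<^bsub>A\<^esub> \<one>\<^bsub>B\<^esub>) J0"
    and J0_left:
      "\<lbrakk>X \<in> Obj A; Y \<in> Obj B\<rbrakk> \<Longrightarrow>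
         boxM (Lun A X) (Lun B Y) \<bullet>\<^bsub>P\<^esub> J \<one>\<^bsub>A\<^esub> \<one>\<^bsub>B\<^esub> X Y \<bullet>\<^bsub>P\<^esub> (J0 \<odot>\<^bsub>P\<^esub> Idt P (boxO X Y)) =
         Lun P (boxO X Y)"
    and J0_right:
      "\<lbrakk>X \<in> Obj A; Y \<in> Obj B\<rbrakk> \<Longrightarrow>
         boxM (Run A X) (Run B Y) \<bullet>\<^bsub>P\<^esub> J X Y \<one>\<^bsub>A\<^esub> \<one>\<^bsub>B\<^esub> \<bullet>\<^bsub>P\<^esub> (Idt P (boxO X Y) \<odot>\<^bsub>P\<^esub> J0) =
         Run P (boxO X Y)"

section \<open>Module categories and internal Homs\<close>

text \<open>
  An action of \<open>D\<close> on \<open>M\<close>: the bifunctor \<open>D \<times> M \<rightarrow> M\<close>, the associativity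
  \<open>ActA X Y M : (X \<otimes> Y) \<otimes> M \<rightarrow> X \<otimes> (Y \<otimes> M)\<close> and the unit \<open>ActU M : \<one> \<otimes> M \<rightarrow> M\<close>.
\<close>

record ('d, 'n, 'o, 'm) action =
  ActO :: "'d \<Rightarrow> 'o \<Rightarrow> 'o"
  ActM :: "'n \<Rightarrow> 'm \<Rightarrow> 'm"
  ActA :: "'d \<Rightarrow> 'd \<Rightarrow> 'o \<Rightarrow> 'm"
  ActU :: "'o \<Rightarrow> 'm"

locale module_category =
  D: linear_monoidal_category D + M: locally_finite_category M +
  act: bilinear_bifunctor D M M "ActO act" "ActM act"
  for D :: "('d, 'n::ab_group_add, 'k::field, 'x) mon_cat_scheme"
    and M :: "('o, 'm::ab_group_add, 'k, 'y) lin_cat_scheme"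
    and act :: "('d, 'n, 'o, 'm) action" +
  assumes act_exact:
      "Z \<in> Obj M \<Longrightarrow> exact D M (\<lambda>X. ActO act X Z) (\<lambda>f. ActM act f (Idt M Z))"
    and act_asc_iso:
      "\<lbrakk>X \<in> Obj D; Y \<in> Obj D; Z \<in> Obj M\<rbrakk> \<Longrightarrow>
         iso_arr M (ActO act (X \<otimes>\<^bsub>D\<^esub> Y) Z) (ActO act X (ActO act Y Z)) (ActA act X Y Z)"
    and act_asc_natural:
      "\<lbrakk>f \<in> Hom D X X'; g \<in> Hom D Y Y'; h \<in> Hom M Z Z'\<rbrakk> \<Longrightarrow>
         ActA act X' Y' Z' \<bullet>\<^bsub>M\<^esub> ActM act (f \<odot>\<^bsub>D\<^esub> g) h =
         ActM act f (ActM act g h) \<bullet>\<^bsub>M\<^esub> ActA act X Y Z"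
    and act_unit_iso: "Z \<in> Obj M \<Longrightarrow> iso_arr M (ActO act \<one>\<^bsub>D\<^esub> Z) Z (ActU act Z)"
    and act_unit_natural:
      "h \<in> Hom M Z Z' \<Longrightarrow>
         ActU act Z' \<bullet>\<^bsub>M\<^esub> ActM act (Idt D \<one>\<^bsub>D\<^esub>) h = h \<bullet>\<^bsub>M\<^esub> ActU act Z"
    and act_pentagon:
      "\<lbrakk>W \<in> Obj D; X \<in> Obj D; Y \<in> Obj D; Z \<in> Obj M\<rbrakk> \<Longrightarrow>
         ActA act W X (ActO act Y Z) \<bullet>\<^bsub>M\<^esub> ActA act (W \<otimes>\<^bsub>D\<^esub> X) Y Z =
         ActM act (Idt D W) (ActA act X Y Z) \<bullet>\<^bsub>M\<^esub> ActA act W (X \<otimes>\<^bsub>D\<^esub> Y) Z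
           \<bullet>\<^bsub>M\<^esub> ActM act (Asc D W X Y) (Idt M Z)"
    and act_triangle:
      "\<lbrakk>X \<in> Obj D; Z \<in> Obj M\<rbrakk> \<Longrightarrow>
         ActM act (Idt D X) (ActU act Z) \<bullet>\<^bsub>M\<^esub> ActA act X \<one>\<^bsub>D\<^esub> Z =
         ActM act (Run D X) (Idt M Z)"

text \<open>
  The action of \<open>D = C \<boxtimes> C\<^sup>o\<^sup>p\<close> on \<open>C\<close> by left and right tensor multiplication: a module category
  structure whose restriction along \<open>\<boxtimes>\<close> is identified, by natural isomorphisms
  \<open>\<theta> X Y Z : (X \<boxtimes> Y) \<otimes> Z \<rightarrow> (X \<otimes> Z) \<otimes> Y\<close> compatible with the associativity and unit of the action, with
  the regular bimodule structure.  In \<open>\<theta>_asc\<close> both sides are arrows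
  \<open>((X \<boxtimes> Y) \<otimes> (X' \<boxtimes> Y')) \<otimes> Z \<rightarrow> (X \<otimes> ((X' \<otimes> Z) \<otimes> Y')) \<otimes> Y\<close>; note that the product of \<open>Y\<close> and \<open>Y'\<close> in
  \<open>C\<^sup>o\<^sup>p\<close> is \<open>Y' \<otimes> Y\<close>.
\<close>

locale regular_bimodule_action = C: linear_monoidal_category C + module_category D C act
  for C :: "('o, 'm::ab_group_add, 'k::field) mon_cat"
    and D :: "('d, 'n::ab_group_add, 'k) mon_cat"
    and boxO :: "'o \<Rightarrow> 'o \<Rightarrow> 'd" and boxM :: "'m \<Rightarrow> 'm \<Rightarrow> 'n"
    and J :: "'o \<Rightarrow> 'o \<Rightarrow> 'o \<Rightarrow> 'o \<Rightarrow> 'n" and J0 :: 'n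
    and act :: "('d, 'n, 'o, 'm) action"
    and \<theta> :: "'o \<Rightarrow> 'o \<Rightarrow> 'o \<Rightarrow> 'm" +
  assumes \<theta>_iso:
      "\<lbrakk>X \<in> Obj C; Y \<in> Obj C; Z \<in> Obj C\<rbrakk> \<Longrightarrow>
         iso_arr C (ActO act (boxO X Y) Z) ((X \<otimes>\<^bsub>C\<^esub> Z) \<otimes>\<^bsub>C\<^esub> Y) (\<theta> X Y Z)"
    and \<theta>_natural:
      "\<lbrakk>f \<in> Hom C X X'; g \<in> Hom C Y Y'; h \<in> Hom C Z Z'\<rbrakk> \<Longrightarrow>
         \<theta> X' Y' Z' \<bullet>\<^bsub>C\<^esub> ActM act (boxM f g) h = ((f \<odot>\<^bsub>C\<^esub> h) \<odot>\<^bsub>C\<^esub> g) \<bullet>\<^bsub>C\<^esub> \<theta> X Y Z"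
    and \<theta>_asc:
      "\<lbrakk>X \<in> Obj C; Y \<in> Obj C; X' \<in> Obj C; Y' \<in> Obj C; Z \<in> Obj C\<rbrakk> \<Longrightarrow>
         \<theta> X Y ((X' \<otimes>\<^bsub>C\<^esub> Z) \<otimes>\<^bsub>C\<^esub> Y')
           \<bullet>\<^bsub>C\<^esub> ActM act (Idt D (boxO X Y)) (\<theta> X' Y' Z)
           \<bullet>\<^bsub>C\<^esub> ActA act (boxO X Y) (boxO X' Y') Z =
         (Asc C X (X' \<otimes>\<^bsub>C\<^esub> Z) Y' \<odot>\<^bsub>C\<^esub> Idt C Y)
           \<bullet>\<^bsub>C\<^esub> inv_arr C (((X \<otimes>\<^bsub>C\<^esub> (X' \<otimes>\<^bsub>C\<^esub> Z)) \<otimes>\<^bsub>C\<^esub> Y') \<otimes>\<^bsub>C\<^esub> Y)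
                ((X \<otimes>\<^bsub>C\<^esub> (X' \<otimes>\<^bsub>C\<^esub> Z)) \<otimes>\<^bsub>C\<^esub> (Y' \<otimes>\<^bsub>C\<^esub> Y))
                (Asc C (X \<otimes>\<^bsub>C\<^esub> (X' \<otimes>\<^bsub>C\<^esub> Z)) Y' Y)
           \<bullet>\<^bsub>C\<^esub> (Asc C X X' Z \<odot>\<^bsub>C\<^esub> Idt C (Y' \<otimes>\<^bsub>C\<^esub> Y))
           \<bullet>\<^bsub>C\<^esub> \<theta> (X \<otimes>\<^bsub>C\<^esub> X') (Y' \<otimes>\<^bsub>C\<^esub> Y) Z
           \<bullet>\<^bsub>C\<^esub> ActM act (J X Y X' Y') (Idt C Z)"
    and \<theta>_unit:
      "Z \<in> Obj C \<Longrightarrow>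
         Lun C Z \<bullet>\<^bsub>C\<^esub> Run C (\<one>\<^bsub>C\<^esub> \<otimes>\<^bsub>C\<^esub> Z) \<bullet>\<^bsub>C\<^esub> \<theta> \<one>\<^bsub>C\<^esub> \<one>\<^bsub>C\<^esub> Z \<bullet>\<^bsub>C\<^esub> ActM act J0 (Idt C Z) =
         ActU act Z"

text \<open>
  \<open>H\<close> is an internal Hom from \<open>M\<^sub>1\<close> to \<open>M\<^sub>2\<close>, with the natural isomorphism of vector spaces
  \<open>\<phi> Y : Hom (Y \<otimes> M\<^sub>1) M\<^sub>2 \<rightarrow> Hom Y H\<close>.
\<close>

definition internal_hom ::
  "('d, 'n::ab_group_add, 'k::field, 'x) mon_cat_scheme
     \<Rightarrow> ('o, 'm::ab_group_add, 'k, 'y) lin_cat_scheme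
     \<Rightarrow> ('d, 'n, 'o, 'm) action \<Rightarrow> 'o \<Rightarrow> 'o \<Rightarrow> 'd \<Rightarrow> ('d \<Rightarrow> 'm \<Rightarrow> 'n) \<Rightarrow> bool" where
  "internal_hom D M act M1 M2 H \<phi> \<longleftrightarrow>
     M1 \<in> Obj M \<and> M2 \<in> Obj M \<and> H \<in> Obj D \<and>
     (\<forall>Y\<in>Obj D. bij_betw (\<phi> Y) (Hom M (ActO act Y M1) M2) (Hom D Y H) \<and>
        (\<forall>f\<in>Hom M (ActO act Y M1) M2. \<forall>g\<in>Hom M (ActO act Y M1) M2.
           \<phi> Y (f + g) = \<phi> Y f + \<phi> Y g) \<and>
        (\<forall>c. \<forall>f\<in>Hom M (ActO act Y M1) M2. \<phi> Y (Scl M c f) = Scl D c (\<phi> Y f))) \<and>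
     (\<forall>Y Y'. \<forall>h\<in>Hom D Y' Y. \<forall>f\<in>Hom M (ActO act Y M1) M2.
        \<phi> Y' (f \<bullet>\<^bsub>M\<^esub> ActM act h (Idt M M1)) = \<phi> Y f \<bullet>\<^bsub>D\<^esub> h)"

record ('d, 'n) algebra_obj =
  Carr :: 'd
  Mult :: 'n
  Unt :: 'n

definition internal_ev ::
  "('d, 'n, 'k, 'x) mon_cat_scheme \<Rightarrow> ('o, 'm, 'k, 'y) lin_cat_scheme
     \<Rightarrow> ('d, 'n, 'o, 'm) action \<Rightarrow> 'o \<Rightarrow> 'o \<Rightarrow> 'd \<Rightarrow> ('d \<Rightarrow> 'm \<Rightarrow> 'n) \<Rightarrow> 'm" where
  "internal_ev D M act M1 M2 H \<phi> =
     inv_into (Hom M (ActO act H M1) M2) (\<phi> H) (Idt D H)"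

text \<open>
  The algebra structure on an internal endomorphism object \<open>H\<close> of \<open>M\<^sub>1\<close>: the multiplication corresponds
  under \<open>\<phi>\<close> to \<open>(H \<otimes> H) \<otimes> M\<^sub>1 \<rightarrow> H \<otimes> (H \<otimes> M\<^sub>1) \<rightarrow> H \<otimes> M\<^sub>1 \<rightarrow> M\<^sub>1\<close>, and the unit to \<open>\<one> \<otimes> M\<^sub>1 \<rightarrow> M\<^sub>1\<close>.
\<close>

definition internal_end_algebra ::
  "('d, 'n, 'k, 'x) mon_cat_scheme \<Rightarrow> ('o, 'm, 'k, 'y) lin_cat_scheme
     \<Rightarrow> ('d, 'n, 'o, 'm) action \<Rightarrow> 'o \<Rightarrow> 'd \<Rightarrow> ('d \<Rightarrow> 'm \<Rightarrow> 'n) \<Rightarrow> ('d, 'n) algebra_obj" where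
  "internal_end_algebra D M act M1 H \<phi> =
     (let ev = internal_ev D M act M1 M1 H \<phi> in
      \<lparr>Carr = H,
       Mult = \<phi> (H \<otimes>\<^bsub>D\<^esub> H) (ev \<bullet>\<^bsub>M\<^esub> ActM act (Idt D H) ev \<bullet>\<^bsub>M\<^esub> ActA act H H M1),
       Unt = \<phi> \<one>\<^bsub>D\<^esub> (ActU act M1)\<rparr>)"

text \<open>
  The canonical algebra \<open>Hom(\<one>, \<one>)\<close> of \<open>C\<close> in \<open>D = C \<boxtimes> C\<^sup>o\<^sup>p\<close>.  That it admits a Frobenius form when
  \<open>C\<close> is unimodular is a property of this algebra, not extra data.
\<close>

definition canonical_algebra ::
  "('o, 'm, 'k) mon_cat \<Rightarrow> ('d, 'n, 'k) mon_cat
     \<Rightarrow> ('d, 'n, 'o, 'm) action \<Rightarrow> 'd \<Rightarrow> ('d \<Rightarrow> 'm \<Rightarrow> 'n) \<Rightarrow> ('d, 'n) algebra_obj" where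
  "canonical_algebra C D act H \<phi> = internal_end_algebra D C act \<one>\<^bsub>C\<^esub> H \<phi>"

definition connected_algebra ::
  "('d, 'n::ab_group_add, 'k::field, 'x) mon_cat_scheme \<Rightarrow> ('d, 'n) algebra_obj \<Rightarrow> bool" where
  "connected_algebra D A \<longleftrightarrow> connected_obj D (Carr A)"

end

theory Submission
  imports Defs
begin

text \<open>
  The internal Hom is defined by \<open>Hom\<^sub>D(Y, H) \<cong> Hom\<^sub>C(Y \<otimes> \<one>, \<one>)\<close>.  At \<open>Y = \<one>\<^sub>D\<close> the unit
  constraint \<open>\<one>\<^sub>D \<otimes> \<one> \<cong> \<one>\<close> of the action turns this into a linear isomorphism
  \<open>Hom\<^sub>D(\<one>\<^sub>D, H) \<cong> End\<^sub>C(\<one>)\<close>, so one side is one-dimensional exactly when the other is.  This is the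
  case \<open>M\<^sub>1 = M\<^sub>2 = \<one>\<close> of \<open>internal_hom_unit_dim\<close>, which holds in every module category.
\<close>

text \<open>
  A linear bijection of subspaces carries a basis to a basis.  As the map is linear only on the
  subspace, it is first replaced by the linear map of the whole space that agrees with it on a basis.
\<close>

lemma dim_eq_of_linear_bij_betw:
  fixes s1 :: "'k::field \<Rightarrow> 'a::ab_group_add \<Rightarrow> 'a" and s2 :: "'k \<Rightarrow> 'b::ab_group_add \<Rightarrow> 'b"
  assumes "vector_space s1" and "vector_space s2"
    and S: "module.subspace s1 S"
    and bij: "bij_betw f S T"
    and add: "\<And>x y. \<lbrakk>x \<in> S; y \<in> S\<rbrakk> \<Longrightarrow> f (x + y) = f x + f y"
    and scl: "\<And>c x. x \<in> S \<Longrightarrow> f (s1 c x) = s2 c (f x)"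
  shows "vector_space.dim s1 S = vector_space.dim s2 T"
proof -
  interpret V: vector_space s1 by fact
  interpret W: vector_space s2 by fact
  interpret VW: vector_space_pair s1 s2 ..
  obtain B where B: "B \<subseteq> S" "V.independent B" "S \<subseteq> V.span B"
    using V.maximal_independent_subset by blast
  have span_B: "V.span B = S"
    using B S V.span_minimal by blast
  define g where "g = VW.construct B f"
  have lin: "Vector_Spaces.linear s1 s2 g"
    unfolding g_def using B(2) by (rule VW.linear_construct)
  interpret g: Vector_Spaces.linear s1 s2 g by (rule lin)
  have "f 0 = 0"
    using add[of 0 0] V.subspace_0[OF S] by simp
  then have "V.subspace {x \<in> S. g x = f x}"
    by (intro V.subspaceI)
      (auto simp: g.add g.scale add scl S V.subspace_0 V.subspace_add V.subspace_scale)
  moreover have "B \<subseteq> {x \<in> S. g x = f x}"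
    using B by (auto simp: g_def VW.construct_basis)
  ultimately have "V.span B \<subseteq> {x \<in> S. g x = f x}"
    by (intro V.span_minimal)
  then have gf: "g x = f x" if "x \<in> S" for x
    using that span_B by auto
  have inj: "inj_on g S"
    using bij gf inj_on_cong[of S g f] by (simp add: bij_betw_def)
  have "g ` S = T"
    using bij gf by (simp add: bij_betw_def)
  then have "W.span (g ` B) = T"
    by (simp add: VW.linear_span_image[OF lin] span_B)
  moreover have "W.independent (g ` B)"
    using B(2) inj by (intro VW.linear_independent_injective_image[OF lin]) (simp_all add: span_B)
  ultimately have "W.dim T = card (g ` B)"
    using W.dim_span_eq_card_independent by blast
  moreover have "card (g ` B) = card B"
    using inj B(1) by (rule card_image[OF inj_on_subset])
  moreover have "V.dim S = card B"
    using V.dim_span_eq_card_independent[OF B(2)] span_B by simp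
  ultimately show ?thesis by simp
qed

lemma (in linear_category) bij_betw_precompose_iso:
  assumes "iso_arr C X Y u" "Z \<in> Obj C"
  shows "bij_betw (\<lambda>f. f \<bullet> u) (Hom C Y Z) (Hom C X Z)"
proof -
  obtain v where u: "u \<in> Hom C X Y" and v: "v \<in> Hom C Y X" "v \<bullet> u = Idt C X" "u \<bullet> v = Idt C Y"
    using assms by (auto simp: iso_arr_def is_inverse_def)
  show ?thesis
  proof (rule bij_betw_byWitness[where f' = "\<lambda>f. f \<bullet> v"])
    show "\<forall>f\<in>Hom C Y Z. f \<bullet> u \<bullet> v = f"
      using cmp_assoc[OF v(1) u] v(3) idt_right by simp
    show "\<forall>f\<in>Hom C X Z. f \<bullet> v \<bullet> u = f"
      using cmp_assoc[OF u v(1)] v(2) idt_right by simp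
  qed (auto intro: cmp_hom[OF u] cmp_hom[OF v(1)])
qed

text \<open>
  The isomorphism sends \<open>f : M\<^sub>1 \<rightarrow> M\<^sub>2\<close> to the arrow \<open>\<one> \<rightarrow> H\<close> that corresponds under \<open>\<phi>\<close> to \<open>f\<close>
  after the unit constraint \<open>\<one> \<otimes> M\<^sub>1 \<rightarrow> M\<^sub>1\<close>.
\<close>

lemma (in module_category) internal_hom_unit_dim:
  assumes "internal_hom D M act M1 M2 H \<phi>"
  shows "vector_space.dim (Scl D) (Hom D \<one>\<^bsub>D\<^esub> H) = vector_space.dim (Scl M) (Hom M M1 M2)"
proof -
  let ?X = "ActO act \<one>\<^bsub>D\<^esub> M1" and ?u = "ActU act M1"
  have M12: "M1 \<in> Obj M" "M2 \<in> Obj M"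
    and \<phi>_bij: "bij_betw (\<phi> \<one>\<^bsub>D\<^esub>) (Hom M ?X M2) (Hom D \<one>\<^bsub>D\<^esub> H)"
    and \<phi>_add: "\<And>f g. \<lbrakk>f \<in> Hom M ?X M2; g \<in> Hom M ?X M2\<rbrakk> \<Longrightarrow>
      \<phi> \<one>\<^bsub>D\<^esub> (f + g) = \<phi> \<one>\<^bsub>D\<^esub> f + \<phi> \<one>\<^bsub>D\<^esub> g"
    and \<phi>_scl: "\<And>c f. f \<in> Hom M ?X M2 \<Longrightarrow> \<phi> \<one>\<^bsub>D\<^esub> (Scl M c f) = Scl D c (\<phi> \<one>\<^bsub>D\<^esub> f)"
    using assms D.unit_obj unfolding internal_hom_def by blast+
  have iso: "iso_arr M ?X M1 ?u"
    using M12(1) by (rule act_unit_iso)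
  then have u: "?u \<in> Hom M ?X M1"
    by (simp add: iso_arr_def)
  have "bij_betw (\<phi> \<one>\<^bsub>D\<^esub> \<circ> (\<lambda>f. f \<bullet>\<^bsub>M\<^esub> ?u)) (Hom M M1 M2) (Hom D \<one>\<^bsub>D\<^esub> H)"
    using M.bij_betw_precompose_iso[OF iso M12(2)] \<phi>_bij by (rule bij_betw_trans)
  then have "vector_space.dim (Scl M) (Hom M M1 M2) = vector_space.dim (Scl D) (Hom D \<one>\<^bsub>D\<^esub> H)"
    by (rule dim_eq_of_linear_bij_betw[OF M.scl D.scl M.hom_subspace[OF M12]])
      (simp_all add: M.cmp_add_left[OF u] M.cmp_scl_left[OF u] M.cmp_hom[OF u] \<phi>_add \<phi>_scl)
  then show ?thesis ..
qed

theorem proposition12p1: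
  fixes C :: "('o, 'm::ab_group_add, 'k::alg_closed_field) mon_cat"
    and D :: "('d, 'n::ab_group_add, 'k) mon_cat"
    and boxO :: "'o \<Rightarrow> 'o \<Rightarrow> 'd" and boxM :: "'m \<Rightarrow> 'm \<Rightarrow> 'n"
    and J :: "'o \<Rightarrow> 'o \<Rightarrow> 'o \<Rightarrow> 'o \<Rightarrow> 'n" and J0 :: 'n
    and act :: "('d, 'n, 'o, 'm) action"
    and \<theta> :: "'o \<Rightarrow> 'o \<Rightarrow> 'o \<Rightarrow> 'm"
    and H :: 'd and \<phi> :: "'d \<Rightarrow> 'm \<Rightarrow> 'n"
  assumes "finite_multitensor_category C"
    and "unimodular C"
    and "monoidal_deligne_product TYPE('e) TYPE('q::ab_group_add) C (rev_mon C) D boxO boxM J J0"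
    and "regular_bimodule_action C D boxO boxM J J0 act \<theta>"
    and "internal_hom D C act \<one>\<^bsub>C\<^esub> \<one>\<^bsub>C\<^esub> H \<phi>"
  shows "connected_algebra D (canonical_algebra C D act H \<phi>) \<longleftrightarrow> tensor_category C"
proof -
  interpret C: finite_multitensor_category C by fact
  interpret R: regular_bimodule_action C D boxO boxM J J0 act \<theta> by fact
  have "Carr (canonical_algebra C D act H \<phi>) = H"
    by (simp add: canonical_algebra_def internal_end_algebra_def Let_def)
  then show ?thesis
    using R.internal_hom_unit_dim[OF assms(5)] C.multitensor_category_axioms
    by (simp add: connected_algebra_def connected_obj_def tensor_category_def)
qed

end
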